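(* Let $f:\mathbb{R}^N\to\mathbb{R}$ be convex and differentiable, let $\psi(x)=\sum_{i=1}^n\psi^i(x^i)$ with each $\psi^i:\mathbb{R}^{N_i}\to\mathbb{R}\cup\{+\infty\}$ convex and closed, and let $F=f+\psi$. Let $\hat S$ be a proper uniform sampling, $\tau=\mathbf{E}[|\hat S|]$, and let $v\in\mathbb{R}^n_{++}$ be such that $(f,\hat S)\sim ESO(v)$. For any optimal solution $x_*$ of the problem of minimizing $F$ over $\mathbb{R}^N$, the output of the Parallel Coordinate Descent Method (PCDM) satisfies, for all $k\ge1$, $$\mathbf{E}[F(x_k)]-F(x_* )\le\frac{n}{(k-1)\tau+n}\left[\Big(1-\frac{\tau}{n}\Big)\big(F(x_0)-F(x_* )\big)+\frac12\|x_0-x_*\|_v^2\right].$$ In particular, for $0<\epsilon<(1-\tau/n)\big(F(x_0)-F(x_* )\big)+\frac12\|x_0-x_*\|_v^2$, if $$k\ge\frac{(n-\tau)\big(F(x_0)-F(x_* )\big)+\frac n2\|x_0-x_*\|_v^2}{\tau\epsilon}-\frac n\tau+1,$$ then $\mathbf{E}[F(x_k)-F(x_* )]\le\epsilon$.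
   Context: Block structure: $\mathbb{R}^N=\mathbb{R}^{N_1}\times\dots\times\mathbb{R}^{N_n}$, $[n]=\{1,\dots,n\}$; $x^i\in\mathbb{R}^{N_i}$ is the $i$th block of $x\in\mathbb{R}^N$, and $U_i$ is the $N\times N_i$ column submatrix of the identity with $x^i=U_i^\top x$. For $S\subseteq[n]$, $h_{[S]}=\sum_{i\in S}U_ih^i$. $\nabla_i f(x)=U_i^\top\nabla f(x)$. $\langle\cdot,\cdot\rangle$ is the standard inner product. For each $i$, $B_i$ is a fixed (symmetric) positive definite $N_i\times N_i$ matrix and $\|x^i\|_i^2=\langle B_ix^i,x^i\rangle$. For $w\in\mathbb{R}^n_{++}$ (vectors with positive entries): $\langle x,y\rangle_w=\sum_i w_i\langle x^i,y^i\rangle$ and $\|x\|_w^2=\sum_i w_i\|x^i\|_i^2$. For vectors in $\mathbb{R}^n$, $\circ$ is the elementwise product. $\mathrm{dom}\,\psi=\{x:\psi(x)<+\infty\}$. Sampling: a sampling $\hat S$ is a random subset of $[n]$; $p_i=\mathrm{Prob}(i\in\hat S)$, $p=(p_1,\dots,p_n)$; it is proper if $p_i>0$ for all $i$, and uniform if all $p_i$ are equal (then $p_i=\mathbf{E}[|\hat S|]/n$). ESO: $(f,\hat S)\sim ESO(v)$ means that for all $x,h\in\mathbb{R}^N$, $\mathbf{E}[f(x+h_{[\hat S]})]\le f(x)+\langle\nabla f(x),h\rangle_p+\frac12\|h\|^2_{v\circ p}$. PCDM: choose $x_0\in\mathrm{dom}\,\psi$. For $k\ge0$: draw a random set $S_k$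 with the distribution of $\hat S$, independently of the past; set $x_{k+1}^i=\arg\min_{x\in\mathbb{R}^{N_i}}\{\langle\nabla_if(x_k),x\rangle+\frac{v_in}{2\tau}\|x-x_k^i\|_i^2+\psi^i(x)\}$ for $i\in S_k$ and $x_{k+1}^i=x_k^i$ for $i\notin S_k$.
   Formalization: The PCDM step uses the proximal coefficient v_i/2 instead of v_i n/(2τ); with the latter the bound fails, e.g. for f(x)=|x|²/2, ψ=0, n=10 blocks of size 1, B_i=1, one block drawn uniformly, v=(1,…,1), k=18. *)

theory Defs
  imports "HOL-Probability.Probability"
begin

text \<open>
  The coordinates of \<^typ>\<open>real ^ 'm\<close> are partitioned into blocks by a surjection
  \<open>b :: 'm \<Rightarrow> 'n\<close>: block \<open>i\<close> consists of the coordinates \<open>j\<close> with \<open>b j = i\<close>. As the block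
  sizes may differ from block to block, the space of \<open>i\<close>-th blocks is represented by
  the subspace of vectors supported on block \<open>i\<close>, that is, a block \<open>y\<close> is represented by \<open>U i y\<close>
  (with \<open>U i\<close> the columns of the identity matrix that belong to block \<open>i\<close>).
\<close>

definition block_space :: "('m \<Rightarrow> 'n) \<Rightarrow> 'n \<Rightarrow> (real ^ 'm) set" where
  "block_space b i = {y. \<forall>j. b j \<noteq> i \<longrightarrow> y $ j = 0}"

definition block :: "('m \<Rightarrow> 'n) \<Rightarrow> 'n \<Rightarrow> real ^ 'm \<Rightarrow> real ^ 'm" where
  "block b i x = (\<chi> j. if b j = i then x $ j else 0)"

definition restrict_blocks :: "('m \<Rightarrow> 'n) \<Rightarrow> 'n set \<Rightarrow> real ^ 'm \<Rightarrow> real ^ 'm" where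
  "restrict_blocks b T h = (\<Sum>i\<in>T. block b i h)"

text \<open>
  The matrix of block \<open>i\<close> is the part of \<open>B i\<close> whose rows and columns both belong to block \<open>i\<close>;
  the remaining entries of \<open>B i\<close> are irrelevant here and in \<open>block_norm\<close>.
\<close>

definition block_pos_def :: "('m::finite \<Rightarrow> 'n) \<Rightarrow> 'n \<Rightarrow> real ^ 'm ^ 'm \<Rightarrow> bool" where
  "block_pos_def b i A \<longleftrightarrow>
     (\<forall>j l. b j = i \<and> b l = i \<longrightarrow> A $ j $ l = A $ l $ j) \<and>
     (\<forall>y\<in>block_space b i. y \<noteq> 0 \<longrightarrow> (A *v y) \<bullet> y > 0)"

definition block_norm :: "('n \<Rightarrow> real ^ 'm ^ 'm) \<Rightarrow> 'n \<Rightarrow> real ^ 'm::finite \<Rightarrow> real" where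
  "block_norm B i y = sqrt ((B i *v y) \<bullet> y)"

definition inner_w :: "('m::finite \<Rightarrow> 'n::finite) \<Rightarrow> real ^ 'n \<Rightarrow> real ^ 'm \<Rightarrow> real ^ 'm \<Rightarrow> real" where
  "inner_w b w x y = (\<Sum>i\<in>UNIV. w $ i * (block b i x \<bullet> block b i y))"

definition norm_w ::
  "('m::finite \<Rightarrow> 'n::finite) \<Rightarrow> ('n \<Rightarrow> real ^ 'm ^ 'm) \<Rightarrow> real ^ 'n \<Rightarrow> real ^ 'm \<Rightarrow> real" where
  "norm_w b B w x = sqrt (\<Sum>i\<in>UNIV. w $ i * (block_norm B i (block b i x))\<^sup>2)"

definition grad :: "('a::real_inner \<Rightarrow> real) \<Rightarrow> 'a \<Rightarrow> 'a" where
  "grad f x = (THE D. GDERIV f x :> D)"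

definition ereal_epigraph :: "'a set \<Rightarrow> ('a \<Rightarrow> ereal) \<Rightarrow> ('a \<times> real) set" where
  "ereal_epigraph A g = {(y, t). y \<in> A \<and> g y \<le> ereal t}"

definition convex_closed_on :: "'a::real_normed_vector set \<Rightarrow> ('a \<Rightarrow> ereal) \<Rightarrow> bool" where
  "convex_closed_on A g \<longleftrightarrow>
     (\<forall>y\<in>A. g y \<noteq> -\<infinity>) \<and> convex (ereal_epigraph A g) \<and> closed (ereal_epigraph A g)"

definition separable_sum ::
  "('m \<Rightarrow> 'n::finite) \<Rightarrow> ('n \<Rightarrow> real ^ 'm \<Rightarrow> ereal) \<Rightarrow> real ^ 'm \<Rightarrow> ereal" where
  "separable_sum b psi x = (\<Sum>i\<in>UNIV. psi i (block b i x))"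

definition composite ::
  "('m \<Rightarrow> 'n::finite) \<Rightarrow> (real ^ 'm \<Rightarrow> real) \<Rightarrow> ('n \<Rightarrow> real ^ 'm \<Rightarrow> ereal) \<Rightarrow> real ^ 'm \<Rightarrow> ereal" where
  "composite b f psi x = ereal (f x) + separable_sum b psi x"

text \<open>A sampling is given by its law, a probability mass function on sets of blocks.\<close>

definition sampling_prob :: "('n::finite) set pmf \<Rightarrow> real ^ 'n" where
  "sampling_prob Shat = (\<chi> i. measure_pmf.prob Shat {T. i \<in> T})"

definition proper_sampling :: "('n::finite) set pmf \<Rightarrow> bool" where
  "proper_sampling Shat \<longleftrightarrow> (\<forall>i. sampling_prob Shat $ i > 0)"

definition uniform_sampling :: "('n::finite) set pmf \<Rightarrow> bool" where
  "uniform_sampling Shat \<longleftrightarrow> (\<forall>i j. sampling_prob Shat $ i = sampling_prob Shat $ j)"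

text \<open>The product of vectors in \<open>v * sampling_prob Shat\<close> is the elementwise one.\<close>

definition ESO ::
  "('m::finite \<Rightarrow> 'n::finite) \<Rightarrow> ('n \<Rightarrow> real ^ 'm ^ 'm) \<Rightarrow>
   (real ^ 'm \<Rightarrow> real) \<Rightarrow> 'n set pmf \<Rightarrow> real ^ 'n \<Rightarrow> bool" where
  "ESO b B f Shat v \<longleftrightarrow>
     (\<forall>x h. measure_pmf.expectation Shat (\<lambda>T. f (x + restrict_blocks b T h))
        \<le> f x + inner_w b (sampling_prob Shat) (grad f x) h
            + 1 / 2 * (norm_w b B (v * sampling_prob Shat) h)\<^sup>2)"

text \<open>
  The proximal coefficient is \<open>v i / 2\<close>, the step matching the ESO inequality for a uniform
  sampling (where the probabilities are \<open>\<tau> / n\<close>, a factor common to the linear and the quadratic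
  term). It is not \<open>v i * n / (2 * \<tau>)\<close>: with that coefficient the stated complexity bound
  fails, e.g. for \<open>f x = (x \<bullet> x) / 2\<close>, \<open>psi = 0\<close>, 10 blocks of size 1, one block drawn
  uniformly, \<open>v = 1\<close> and \<open>k = 18\<close>. Replacing \<open>v\<close> by \<open>(n / \<tau>) v\<close> gives the smaller step.
\<close>

definition pcdm_step ::
  "('m::finite \<Rightarrow> 'n) \<Rightarrow> ('n \<Rightarrow> real ^ 'm ^ 'm) \<Rightarrow> (real ^ 'm \<Rightarrow> real) \<Rightarrow>
   ('n \<Rightarrow> real ^ 'm \<Rightarrow> ereal) \<Rightarrow> real ^ 'n::finite \<Rightarrow> 'n set \<Rightarrow> real ^ 'm \<Rightarrow> real ^ 'm \<Rightarrow> bool" where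
  "pcdm_step b B f psi v T x x' \<longleftrightarrow>
     (\<forall>i\<in>T. is_arg_min
        (\<lambda>y. ereal (block b i (grad f x) \<bullet> y + v $ i / 2 * (block_norm B i (y - block b i x))\<^sup>2)
              + psi i y)
        (\<lambda>y. y \<in> block_space b i) (block b i x')) \<and>
     (\<forall>i. i \<notin> T \<longrightarrow> block b i x' = block b i x)"

text \<open>
  Each set \<open>S k\<close> has law \<open>Shat\<close>, and the sets are mutually independent; as the starting point is
  deterministic, this makes \<open>S k\<close> independent of the past.
\<close>

definition pcdm ::
  "('m::finite \<Rightarrow> 'n::finite) \<Rightarrow> ('n \<Rightarrow> real ^ 'm ^ 'm) \<Rightarrow> (real ^ 'm \<Rightarrow> real) \<Rightarrow>
   ('n \<Rightarrow> real ^ 'm \<Rightarrow> ereal) \<Rightarrow> real ^ 'n \<Rightarrow> 'n set pmf \<Rightarrow> 'a measure \<Rightarrow>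
   (nat \<Rightarrow> 'a \<Rightarrow> 'n set) \<Rightarrow> real ^ 'm \<Rightarrow> (nat \<Rightarrow> 'a \<Rightarrow> real ^ 'm) \<Rightarrow> bool" where
  "pcdm b B f psi v Shat M S x0 X \<longleftrightarrow>
     prob_space M \<and>
     prob_space.indep_vars M (\<lambda>_. count_space UNIV) S UNIV \<and>
     (\<forall>k. distr M (count_space UNIV) (S k) = measure_pmf Shat) \<and>
     separable_sum b psi x0 < \<infinity> \<and>
     (\<forall>\<omega>\<in>space M. X 0 \<omega> = x0 \<and> (\<forall>k. pcdm_step b B f psi v (S k \<omega>) (X k \<omega>) (X (Suc k) \<omega>)))"

text \<open>
  The Lebesgue integral of the positive part minus that of the negative part. As
  \<open>\<infinity> - \<infinity> = \<infinity>\<close> in \<^typ>\<open>ereal\<close>, a finite upper bound excludes the undefined case.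
\<close>

definition ereal_expectation :: "'a measure \<Rightarrow> ('a \<Rightarrow> ereal) \<Rightarrow> ereal" where
  "ereal_expectation M Y =
     enn2ereal (\<integral>\<^sup>+ \<omega>. e2ennreal (Y \<omega>) \<partial>M) - enn2ereal (\<integral>\<^sup>+ \<omega>. e2ennreal (- Y \<omega>) \<partial>M)"

end

theory Submission
  imports Defs
begin

text \<open>
  Write \<open>\<alpha> = \<tau> / n\<close>, which is the probability that a given block is updated, and let \<open>z\<close> collect
  the minimisers of the block subproblems at \<open>x\<close>, so that the next iterate \<open>x\<^sup>+\<close> agrees with \<open>z\<close> on
  the drawn blocks and with \<open>x\<close> elsewhere. The ESO inequality and the separability of \<open>psi\<close> give
  \<open>\<bbbE> F x\<^sup>+ \<le> (1 - \<alpha>) F x + \<alpha> m x z\<close>, where \<open>m x\<close> is the model of \<open>F\<close> that the subproblems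
  minimise (\<open>expectation_model\<close>). The model is strongly convex, so its minimiser satisfies
  \<open>m x z + \<parallel>y - z\<parallel>\<^sup>2 / 2 \<le> m x y\<close> for every feasible \<open>y\<close> (\<open>prox_point_inequality\<close>). As squared
  distances are separable as well, \<open>\<bbbE> \<parallel>x\<^sup>+ - y\<parallel>\<^sup>2 = (1 - \<alpha>) \<parallel>x - y\<parallel>\<^sup>2 + \<alpha> \<parallel>z - y\<parallel>\<^sup>2\<close>, and
  \<open>m x y \<le> F y + \<parallel>x - y\<parallel>\<^sup>2 / 2\<close> by convexity of \<open>f\<close>. Together these yield the recursion
  \<open>\<bbbE> (F x\<^sup>+ - F y) + \<bbbE> \<parallel>x\<^sup>+ - y\<parallel>\<^sup>2 / 2 \<le> (1 - \<alpha>) (F x - F y) + \<parallel>x - y\<parallel>\<^sup>2 / 2\<close>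
  (\<open>expected_progress\<close>), while \<open>y = x\<close> shows that \<open>F\<close> decreases in expectation
  (\<open>expected_decrease\<close>). Telescoping the recursion along the run and bounding every expected gap
  from below by the last one gives the rate (\<open>sublinear_rate\<close>); the iteration count of the second
  claim is the rate solved for \<open>k\<close>.

  The probabilistic part is elementary because the sampling takes finitely many values. Minimisers
  of the subproblems are unique, so the iterates form a deterministic orbit driven by the independent
  draws, each iterate takes finitely many values, and it is independent of the next draw. The
  minimisers exist for a probabilistic reason: a run of the method exhibits a minimiser for every
  block drawn, and every block is drawn with positive probability independently of the past, so
  almost surely all blocks have a minimiser at the current iterate
  (\<open>AE_orbit_all_inputs\<close>, \<open>AE_prox_point\<close>).
\<close>

section \<open>Orbits driven by independent inputs\<close>

primrec orbit :: "('x \<Rightarrow> 's \<Rightarrow> 'x) \<Rightarrow> 'x \<Rightarrow> (nat \<Rightarrow> 's) \<Rightarrow> nat \<Rightarrow> 'x" where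
  "orbit st y s 0 = y"
| "orbit st y s (Suc k) = st (orbit st y s k) (s k)"

lemma orbit_cong: "(\<And>j. j < k \<Longrightarrow> s j = s' j) \<Longrightarrow> orbit st y s k = orbit st y s' k"
  by (induction k) auto

text \<open>The orbit up to time \<open>k\<close> depends on the first \<open>k\<close> inputs only, a finite set of histories.\<close>

lemma finite_range_orbit:
  fixes s :: "'a \<Rightarrow> nat \<Rightarrow> 's::finite"
  shows "finite (range (\<lambda>\<omega>. orbit st y (s \<omega>) k))"
proof (rule finite_subset)
  show "range (\<lambda>\<omega>. orbit st y (s \<omega>) k) \<subseteq> (\<lambda>r. orbit st y r k) ` ({..<k} \<rightarrow>\<^sub>E UNIV)"
  proof
    fix u assume "u \<in> range (\<lambda>\<omega>. orbit st y (s \<omega>) k)"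
    then obtain \<omega> where "u = orbit st y (s \<omega>) k" by blast
    also have "\<dots> = orbit st y (restrict (s \<omega>) {..<k}) k"
      by (rule orbit_cong) simp
    finally show "u \<in> (\<lambda>r. orbit st y r k) ` ({..<k} \<rightarrow>\<^sub>E UNIV)"
      by auto
  qed
  show "finite ((\<lambda>r. orbit st y r k) ` ({..<k} \<rightarrow>\<^sub>E (UNIV::'s set)))"
    by (intro finite_imageI finite_PiE) auto
qed

lemma PiM_finite_type:
  assumes "finite A"
  shows "PiM A (\<lambda>_. count_space (UNIV :: 's::finite set)) = count_space (A \<rightarrow>\<^sub>E UNIV)"
  using assms by (intro count_space_PiM_finite) auto

context prob_space
begin

lemma integrable_finite_range:
  fixes g :: "'x \<Rightarrow> real"
  assumes "Y \<in> M \<rightarrow>\<^sub>M count_space UNIV" and "finite (range Y)"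
  shows "integrable M (\<lambda>\<omega>. g (Y \<omega>))"
proof (rule integrable_const_bound)
  show "AE \<omega> in M. norm (g (Y \<omega>)) \<le> (\<Sum>y\<in>range Y. \<bar>g y\<bar>)"
    using assms(2) by (auto intro!: AE_I2 member_le_sum)
  show "(\<lambda>\<omega>. g (Y \<omega>)) \<in> borel_measurable M"
    using measurable_compose[OF assms(1), of g borel] by simp
qed

context
  fixes S :: "nat \<Rightarrow> 'a \<Rightarrow> 's::finite" and P :: "'s pmf"
  assumes indep: "indep_vars (\<lambda>_. count_space UNIV) S UNIV"
    and law: "\<And>k. distr M (count_space UNIV) (S k) = measure_pmf P"
begin

lemma S_measurable: "S k \<in> M \<rightarrow>\<^sub>M count_space UNIV"
  using indep by (auto simp: indep_vars_def)

lemma orbit_measurable: "(\<lambda>\<omega>. orbit st y (\<lambda>j. S j \<omega>) k) \<in> M \<rightarrow>\<^sub>M count_space UNIV"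
proof -
  have "(\<lambda>\<omega>. restrict (\<lambda>i. S i \<omega>) {..<k}) \<in> M \<rightarrow>\<^sub>M PiM {..<k} (\<lambda>_. count_space UNIV)"
    by (intro measurable_restrict S_measurable)
  then have "(\<lambda>\<omega>. orbit st y (restrict (\<lambda>i. S i \<omega>) {..<k}) k) \<in> M \<rightarrow>\<^sub>M count_space UNIV"
    by (rule measurable_compose) (simp add: PiM_finite_type)
  moreover have "orbit st y (restrict (\<lambda>i. S i \<omega>) {..<k}) k = orbit st y (\<lambda>j. S j \<omega>) k" for \<omega>
    by (rule orbit_cong) simp
  ultimately show ?thesis by simp
qed

lemma integrable_orbit:
  fixes g :: "'x \<Rightarrow> real"
  shows "integrable M (\<lambda>\<omega>. g (orbit st y (\<lambda>j. S j \<omega>) k))"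
  by (rule integrable_finite_range[OF orbit_measurable finite_range_orbit])

text \<open>
  The state at time \<open>k\<close> is a function of the inputs before time \<open>k\<close>. Independence is expressed for
  real functions of the state and of the input because \<open>indep_var\<close> relates variables with values in
  the same type.
\<close>

lemma indep_var_orbit:
  fixes g :: "'x \<Rightarrow> real" and g' :: "'s \<Rightarrow> real"
  shows "indep_var borel (\<lambda>\<omega>. g (orbit st y (\<lambda>j. S j \<omega>) k)) borel (\<lambda>\<omega>. g' (S k \<omega>))"
proof -
  have "indep_var borel ((\<lambda>r. g (orbit st y r k)) \<circ> (\<lambda>\<omega>. restrict (\<lambda>i. S i \<omega>) {..<k}))
          borel ((\<lambda>r. g' (r k)) \<circ> (\<lambda>\<omega>. restrict (\<lambda>i. S i \<omega>) {k}))"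
    by (rule indep_var_compose[OF indep_var_restrict[OF indep]]) (auto simp: PiM_finite_type)
  moreover have "orbit st y (restrict (\<lambda>i. S i \<omega>) {..<k}) k = orbit st y (\<lambda>j. S j \<omega>) k" for \<omega>
    by (rule orbit_cong) simp
  ultimately show ?thesis by (simp add: comp_def)
qed

lemma
  fixes g :: "'x \<Rightarrow> real"
  shows expectation_orbit_input:
      "expectation (\<lambda>\<omega>. g (orbit st y (\<lambda>j. S j \<omega>) k) * indicator {s} (S k \<omega>))
        = expectation (\<lambda>\<omega>. g (orbit st y (\<lambda>j. S j \<omega>) k)) * pmf P s"
    and integrable_orbit_input:
      "integrable M (\<lambda>\<omega>. g (orbit st y (\<lambda>j. S j \<omega>) k) * indicator {s} (S k \<omega>))"
proof -
  have int: "integrable M (\<lambda>\<omega>. indicator {s} (S k \<omega>) :: real)"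
    by (rule integrable_finite_range[OF S_measurable]) simp
  have int': "integrable M (\<lambda>\<omega>. g (orbit st y (\<lambda>j. S j \<omega>) k))"
    by (rule integrable_orbit)
  have "expectation (\<lambda>\<omega>. indicator {s} (S k \<omega>) :: real)
      = integral\<^sup>L (distr M (count_space UNIV) (S k)) (indicator {s})"
    by (rule integral_distr[symmetric, OF S_measurable]) simp
  also have "\<dots> = pmf P s"
    by (simp add: law measure_pmf_single)
  finally show "expectation (\<lambda>\<omega>. g (orbit st y (\<lambda>j. S j \<omega>) k) * indicator {s} (S k \<omega>))
        = expectation (\<lambda>\<omega>. g (orbit st y (\<lambda>j. S j \<omega>) k)) * pmf P s"
    using indep_var_lebesgue_integral[OF indep_var_orbit int' int] by simp
  show "integrable M (\<lambda>\<omega>. g (orbit st y (\<lambda>j. S j \<omega>) k) * indicator {s} (S k \<omega>))"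
    by (rule indep_var_integrable[OF indep_var_orbit int' int])
qed

text \<open>
  The tower rule for one step: split the expectation according to the value of the \<open>k\<close>-th input,
  which is independent of the state that it acts on.
\<close>

lemma expectation_orbit_Suc:
  fixes g :: "'x \<Rightarrow> real"
  shows "expectation (\<lambda>\<omega>. g (orbit st y (\<lambda>j. S j \<omega>) (Suc k)))
    = expectation (\<lambda>\<omega>. measure_pmf.expectation P (\<lambda>s. g (st (orbit st y (\<lambda>j. S j \<omega>) k) s)))"
proof -
  let ?Y = "\<lambda>\<omega>. orbit st y (\<lambda>j. S j \<omega>) k"
  have split: "g (st u s) = (\<Sum>s'\<in>UNIV. g (st u s') * indicator {s'} s)" for u s
    by (simp add: indicator_def if_distrib sum.delta cong: if_cong)
  have "expectation (\<lambda>\<omega>. g (orbit st y (\<lambda>j. S j \<omega>) (Suc k)))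
      = expectation (\<lambda>\<omega>. \<Sum>s\<in>UNIV. g (st (?Y \<omega>) s) * indicator {s} (S k \<omega>))"
    unfolding orbit.simps by (intro Bochner_Integration.integral_cong refl split)
  also have "\<dots> = (\<Sum>s\<in>UNIV. expectation (\<lambda>\<omega>. g (st (?Y \<omega>) s) * indicator {s} (S k \<omega>)))"
    by (intro Bochner_Integration.integral_sum
        integrable_orbit_input[where g = "\<lambda>u. g (st u s)" for s])
  also have "\<dots> = (\<Sum>s\<in>UNIV. expectation (\<lambda>\<omega>. g (st (?Y \<omega>) s)) * pmf P s)"
    by (intro sum.cong refl expectation_orbit_input[where g = "\<lambda>u. g (st u s)" for s])
  also have "\<dots> = expectation (\<lambda>\<omega>. \<Sum>s\<in>UNIV. g (st (?Y \<omega>) s) * pmf P s)"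
    by (simp add: Bochner_Integration.integral_sum integrable_orbit[of "\<lambda>u. g (st u s)" for s])
  also have "\<dots> = expectation (\<lambda>\<omega>. measure_pmf.expectation P (\<lambda>s. g (st (?Y \<omega>) s)))"
    by (subst integral_measure_pmf_real[of UNIV]) auto
  finally show ?thesis .
qed

text \<open>
  If \<open>R\<close> failed with positive probability between the state and some input \<open>s\<close> of positive
  probability, then, by independence, with positive probability it would fail between the state and
  the input actually drawn.
\<close>

lemma AE_orbit_all_inputs:
  assumes "\<And>\<omega>. \<omega> \<in> space M \<Longrightarrow> R (orbit st y (\<lambda>j. S j \<omega>) k) (S k \<omega>)"
  shows "AE \<omega> in M. \<forall>s\<in>set_pmf P. R (orbit st y (\<lambda>j. S j \<omega>) k) s"
proof -
  let ?Y = "\<lambda>\<omega>. orbit st y (\<lambda>j. S j \<omega>) k"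
  have "AE \<omega> in M. R (?Y \<omega>) s" if "s \<in> set_pmf P" for s
  proof -
    let ?bad = "indicator {u. \<not> R u s} :: _ \<Rightarrow> real"
    have "expectation (\<lambda>\<omega>. ?bad (?Y \<omega>) * indicator {s} (S k \<omega>)) = expectation (\<lambda>_. 0)"
      using assms by (intro Bochner_Integration.integral_cong) (auto simp: indicator_def)
    with that have "expectation (\<lambda>\<omega>. ?bad (?Y \<omega>)) = 0"
      by (simp add: expectation_orbit_input set_pmf_iff)
    then have "AE \<omega> in M. ?bad (?Y \<omega>) = 0"
      by (subst (asm) integral_nonneg_eq_0_iff_AE[OF integrable_orbit]) auto
    then show ?thesis by (auto simp: indicator_def)
  qed
  then show ?thesis
    by (simp add: AE_ball_countable countable_finite)
qed

end

end

section \<open>Blocks, block norms and the gradient inequality\<close>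

text \<open>
  Restricting \<open>f\<close> to the line through \<open>x\<close> and \<open>y\<close> reduces the claim to the tangent inequality for
  convex functions of one variable. The first half identifies \<open>grad f x\<close>, a definite description,
  with the vector that represents the derivative.
\<close>

lemma gradient_inequality:
  fixes f :: "'a::euclidean_space \<Rightarrow> real"
  assumes "convex_on UNIV f" and "f differentiable_on UNIV"
  shows "f x + grad f x \<bullet> (y - x) \<le> f y"
proof -
  obtain f' where f': "(f has_derivative f') (at x)"
    using assms(2) by (auto simp: differentiable_on_def differentiable_def)
  define D where "D = (\<Sum>e\<in>Basis. f' e *\<^sub>R e)"
  have lin: "linear f'" using f' by (rule has_derivative_linear)
  have "f' h = h \<bullet> D" for h
  proof -
    have "f' h = f' (\<Sum>e\<in>Basis. (h \<bullet> e) *\<^sub>R e)" by (simp add: euclidean_representation)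
    also have "\<dots> = h \<bullet> D"
      using lin by (simp add: D_def linear_sum linear_scale inner_sum_right mult.commute)
    finally show ?thesis .
  qed
  then have f'_eq: "f' = (\<lambda>h. h \<bullet> D)" by (rule ext)
  have D: "GDERIV f x :> D"
    using f' unfolding gderiv_def f'_eq .
  have "D' = D" if "GDERIV f x :> D'" for D'
  proof -
    have "(\<lambda>h. h \<bullet> D') = (\<lambda>h. h \<bullet> D)"
      using that D unfolding gderiv_def by (rule has_derivative_unique)
    from fun_cong[OF this, of "D' - D"] have "(D' - D) \<bullet> D' = (D' - D) \<bullet> D" .
    then have "(D' - D) \<bullet> (D' - D) = 0" by (simp add: inner_diff_right)
    then show ?thesis by simp
  qed
  with D have grad: "grad f x = D"
    unfolding grad_def by (rule the_equality)
  define g where "g = (\<lambda>t. f (x + t *\<^sub>R (y - x)))"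
  have "convex_on UNIV g"
  proof (rule convex_onI)
    fix t u w :: real assume t: "0 < t" "t < 1"
    have "x + ((1 - t) *\<^sub>R u + t *\<^sub>R w) *\<^sub>R (y - x)
        = (1 - t) *\<^sub>R (x + u *\<^sub>R (y - x)) + t *\<^sub>R (x + w *\<^sub>R (y - x))"
      by (simp add: algebra_simps)
    with t show "g ((1 - t) *\<^sub>R u + t *\<^sub>R w) \<le> (1 - t) * g u + t * g w"
      unfolding g_def using convex_onD[OF assms(1), of t] by simp
  qed simp
  moreover have "(g has_field_derivative (y - x) \<bullet> D) (at 0)"
  proof -
    have "((\<lambda>t. x + t *\<^sub>R (y - x)) has_derivative (\<lambda>t. t *\<^sub>R (y - x))) (at 0)"
      by (auto intro!: derivative_eq_intros)
    moreover have "(f has_derivative (\<lambda>h. h \<bullet> D)) (at (x + 0 *\<^sub>R (y - x)))"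
      using D by (simp add: gderiv_def)
    ultimately have "(f \<circ> (\<lambda>t. x + t *\<^sub>R (y - x)) has_derivative
        (\<lambda>h. h \<bullet> D) \<circ> (\<lambda>t. t *\<^sub>R (y - x))) (at 0)"
      by (rule diff_chain_at)
    then show ?thesis
      by (simp add: has_field_derivative_def g_def comp_def mult_commute_abs)
  qed
  ultimately have "g 1 - g 0 \<ge> ((y - x) \<bullet> D) * (1 - 0)"
    by (intro convex_on_imp_above_tangent[of UNIV]) auto
  then show ?thesis by (simp add: g_def grad inner_commute)
qed

lemma block_nth [simp]: "block b i x $ j = (if b j = i then x $ j else 0)"
  by (simp add: block_def)

lemma block_in_block_space [simp]: "block b i x \<in> block_space b i"
  by (simp add: block_space_def)

lemma block_diff [simp]: "block b i (x - y) = block b i x - block b i y"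
  by (simp add: vec_eq_iff)

lemma block_space_diff [simp]:
  "y \<in> block_space b i \<Longrightarrow> z \<in> block_space b i \<Longrightarrow> y - z \<in> block_space b i"
  by (simp add: block_space_def)

lemma blocks_determine: "(\<And>i. block b i x = block b i y) \<Longrightarrow> x = y"
  unfolding vec_eq_iff by (metis block_nth)

lemma sum_inner_block:
  fixes b :: "'m::finite \<Rightarrow> 'n::finite"
  shows "(\<Sum>i\<in>UNIV. block b i x \<bullet> block b i y) = x \<bullet> y"
proof -
  have "(\<Sum>i\<in>UNIV. block b i x \<bullet> block b i y) = (\<Sum>i\<in>UNIV. \<Sum>j\<in>UNIV. if b j = i then x $ j * y $ j else 0)"
    by (auto simp: inner_vec_def intro!: sum.cong)
  also have "\<dots> = (\<Sum>j\<in>UNIV. \<Sum>i\<in>UNIV. if b j = i then x $ j * y $ j else 0)"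
    by (rule sum.swap)
  also have "\<dots> = x \<bullet> y" by (simp add: inner_vec_def)
  finally show ?thesis .
qed

lemma block_restrict_blocks:
  fixes b :: "'m::finite \<Rightarrow> 'n::finite"
  shows "block b i (x + restrict_blocks b T (z - x)) = (if i \<in> T then block b i z else block b i x)"
  by (auto simp: vec_eq_iff restrict_blocks_def if_distrib sum.delta cong: if_cong)

lemma block_form_sym:
  assumes "block_pos_def b i A" "y \<in> block_space b i" "z \<in> block_space b i"
  shows "(A *v y) \<bullet> z = (A *v z) \<bullet> y"
proof -
  have "(A *v y) \<bullet> z = (\<Sum>j\<in>UNIV. \<Sum>l\<in>UNIV. A $ j $ l * y $ l * z $ j)"
    by (simp add: inner_vec_def matrix_vector_mult_def sum_distrib_right)
  also have "\<dots> = (\<Sum>j\<in>UNIV. \<Sum>l\<in>UNIV. A $ l $ j * y $ l * z $ j)"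
  proof (intro sum.cong refl)
    fix j l
    show "A $ j $ l * y $ l * z $ j = A $ l $ j * y $ l * z $ j"
      using assms by (cases "b j = i \<and> b l = i") (auto simp: block_pos_def_def block_space_def)
  qed
  also have "\<dots> = (\<Sum>l\<in>UNIV. \<Sum>j\<in>UNIV. A $ l $ j * y $ l * z $ j)"
    by (rule sum.swap)
  also have "\<dots> = (A *v z) \<bullet> y"
    by (simp add: inner_vec_def matrix_vector_mult_def sum_distrib_left mult_ac)
  finally show ?thesis .
qed

lemma block_norm_sq:
  assumes "block_pos_def b i (B i)" "y \<in> block_space b i"
  shows "(block_norm B i y)\<^sup>2 = (B i *v y) \<bullet> y"
proof -
  have "0 \<le> (B i *v y) \<bullet> y"
    using assms by (cases "y = 0") (auto simp: block_pos_def_def less_imp_le)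
  then show ?thesis by (simp add: block_norm_def)
qed

lemma block_norm_eq_0:
  assumes "block_pos_def b i (B i)" "y \<in> block_space b i" "(block_norm B i y)\<^sup>2 \<le> 0"
  shows "y = 0"
  using assms by (auto simp: block_norm_sq block_pos_def_def)

lemma block_norm_minus_commute: "block_norm B i (y - z) = block_norm B i (z - y)"
proof -
  have "block_norm B i (- u) = block_norm B i u" for u
    by (simp add: block_norm_def linear_neg[OF matrix_vector_mul_linear])
  from this[of "z - y"] show ?thesis by simp
qed

text \<open>
  The squared block norm comes from a symmetric bilinear form, so it is quadratic along segments;
  the last term is what makes the proximal subproblems strongly convex.
\<close>

lemma block_norm_segment:
  assumes "block_pos_def b i (B i)" "x \<in> block_space b i" "y \<in> block_space b i" "z \<in> block_space b i"
  shows "(block_norm B i ((1 - t) *\<^sub>R y + t *\<^sub>R z - x))\<^sup>2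
    = (1 - t) * (block_norm B i (y - x))\<^sup>2 + t * (block_norm B i (z - x))\<^sup>2
      - t * (1 - t) * (block_norm B i (z - y))\<^sup>2"
proof -
  define u w where "u = y - x" and "w = z - x"
  have uw: "u \<in> block_space b i" "w \<in> block_space b i"
    using assms by (auto simp: u_def w_def)
  have e: "(1 - t) *\<^sub>R y + t *\<^sub>R z - x = (1 - t) *\<^sub>R u + t *\<^sub>R w" "z - y = w - u"
    by (auto simp: u_def w_def algebra_simps)
  have m: "(1 - t) *\<^sub>R u + t *\<^sub>R w \<in> block_space b i" "w - u \<in> block_space b i"
    using uw by (auto simp: block_space_def)
  have sq: "(block_norm B i y)\<^sup>2 = (B i *v y) \<bullet> y" if "y \<in> block_space b i" for y
    using assms(1) that by (rule block_norm_sq)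
  have sym: "(B i *v w) \<bullet> u = (B i *v u) \<bullet> w"
    by (rule block_form_sym[OF assms(1) uw(2,1)])
  have comb: "(B i *v ((1 - t) *\<^sub>R u + t *\<^sub>R w)) \<bullet> ((1 - t) *\<^sub>R u + t *\<^sub>R w)
      = (1 - t)\<^sup>2 * ((B i *v u) \<bullet> u) + t * (1 - t) * ((B i *v u) \<bullet> w)
        + t * (1 - t) * ((B i *v w) \<bullet> u) + t\<^sup>2 * ((B i *v w) \<bullet> w)"
    unfolding matrix_vector_right_distrib matrix_vector_mult_scaleR inner_add_left inner_add_right
      inner_scaleR_left inner_scaleR_right
    by (simp add: power2_eq_square algebra_simps)
  have diff: "(B i *v (w - u)) \<bullet> (w - u)
      = (B i *v w) \<bullet> w - (B i *v w) \<bullet> u - (B i *v u) \<bullet> w + (B i *v u) \<bullet> u"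
    by (simp add: matrix_vector_mult_diff_distrib inner_diff_left inner_diff_right)
  show ?thesis
    unfolding e u_def[symmetric] w_def[symmetric] sq[OF uw(1)] sq[OF uw(2)] sq[OF m(1)] sq[OF m(2)]
      comb diff sym
    by (simp add: power2_eq_square algebra_simps)
qed

lemma norm_w_sq:
  assumes "\<And>i. 0 \<le> w $ i"
  shows "(norm_w b B w x)\<^sup>2 = (\<Sum>i\<in>UNIV. w $ i * (block_norm B i (block b i x))\<^sup>2)"
  unfolding norm_w_def using assms by (intro real_sqrt_pow2 sum_nonneg mult_nonneg_nonneg) auto

section \<open>Proximal steps\<close>

text \<open>
  Compare the minimiser \<open>xh\<close> with the point at fraction \<open>t\<close> of the segment from \<open>xh\<close> to \<open>y\<close>. The
  objective there is at most the convex combination of the two values minus \<open>t (1 - t) c Q (y - xh)\<close>.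
  Dividing by \<open>t\<close> and letting \<open>t\<close> tend to \<open>0\<close> leaves the full quadratic gap \<open>c Q (y - xh)\<close>.
\<close>

lemma prox_inequality:
  fixes A :: "'a::real_inner set" and Q :: "'a \<Rightarrow> real"
  assumes epi: "convex (ereal_epigraph A \<psi>)"
    and fin: "\<And>y. y \<in> A \<Longrightarrow> \<psi> y \<noteq> -\<infinity>"
    and Q: "\<And>y z t. y \<in> A \<Longrightarrow> z \<in> A \<Longrightarrow> Q ((1 - t) *\<^sub>R y + t *\<^sub>R z - x)
        = (1 - t) * Q (y - x) + t * Q (z - x) - t * (1 - t) * Q (z - y)"
    and min: "is_arg_min (\<lambda>y. ereal (g \<bullet> y + c * Q (y - x)) + \<psi> y) (\<lambda>y. y \<in> A) xh"
    and y: "y \<in> A" "\<psi> y < \<infinity>"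
  shows "\<psi> xh < \<infinity>"
    and "g \<bullet> xh + c * Q (xh - x) + real_of_ereal (\<psi> xh) + c * Q (y - xh)
      \<le> g \<bullet> y + c * Q (y - x) + real_of_ereal (\<psi> y)"
proof -
  have xh: "xh \<in> A" and le: "\<And>z. z \<in> A \<Longrightarrow>
      ereal (g \<bullet> xh + c * Q (xh - x)) + \<psi> xh \<le> ereal (g \<bullet> z + c * Q (z - x)) + \<psi> z"
    using min by (auto simp: is_arg_min_def not_less)
  show fin_xh: "\<psi> xh < \<infinity>"
    using le[OF y(1)] y fin[OF y(1)] by (cases "\<psi> y"; cases "\<psi> xh") auto
  obtain s where s: "\<psi> y = ereal s" using y fin[OF y(1)] by (cases "\<psi> y") auto
  obtain sh where sh: "\<psi> xh = ereal sh" using fin_xh fin[OF xh] by (cases "\<psi> xh") auto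
  define P R D where "P = g \<bullet> xh + c * Q (xh - x) + sh"
    and "R = g \<bullet> y + c * Q (y - x) + s" and "D = c * Q (y - xh)"
  have step: "P + D - R \<le> t * D" if t: "0 < t" "t \<le> 1" for t
  proof -
    define z where "z = (1 - t) *\<^sub>R xh + t *\<^sub>R y"
    have "(1 - t) *\<^sub>R (xh, sh) + t *\<^sub>R (y, s) \<in> ereal_epigraph A \<psi>"
      using t s sh y xh by (intro convexD_alt[OF epi]) (auto simp: ereal_epigraph_def)
    then have z: "z \<in> A" "\<psi> z \<le> ereal ((1 - t) * sh + t * s)"
      by (auto simp: ereal_epigraph_def z_def)
    have "ereal P \<le> ereal (g \<bullet> z + c * Q (z - x)) + \<psi> z"
      using le[OF z(1)] by (simp add: P_def sh)
    also have "\<dots> \<le> ereal (g \<bullet> z + c * Q (z - x)) + ereal ((1 - t) * sh + t * s)"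
      by (rule add_left_mono[OF z(2)])
    finally have "P \<le> g \<bullet> z + c * Q (z - x) + ((1 - t) * sh + t * s)"
      by simp
    also have "\<dots> = (1 - t) * P + t * R - t * (1 - t) * D"
      unfolding P_def R_def D_def z_def Q[OF xh y(1)] by (simp add: inner_simps algebra_simps)
    finally have "t * (P + D - R) \<le> t * (t * D)"
      by (simp add: algebra_simps)
    with t show ?thesis by simp
  qed
  have "P + D - R \<le> 0"
  proof (rule ccontr)
    assume "\<not> P + D - R \<le> 0"
    then have e: "0 < P + D - R" "P + D - R \<le> D"
      using step[of 1] by auto
    \<comment> \<open>A fraction so small that the bound \<open>t D\<close> falls to half of the presumed excess.\<close>
    have "P + D - R \<le> ((P + D - R) / (2 * D)) * D"
      using e by (intro step) (auto simp: field_simps)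
    also have "\<dots> = (P + D - R) / 2"
      using e by simp
    finally show False using e by simp
  qed
  then show "g \<bullet> xh + c * Q (xh - x) + real_of_ereal (\<psi> xh) + c * Q (y - xh)
      \<le> g \<bullet> y + c * Q (y - x) + real_of_ereal (\<psi> y)"
    by (simp add: P_def D_def R_def s sh)
qed

text \<open>
  On the domain of \<open>separable_sum b psi\<close> all summands are finite (the value \<open>-\<infinity>\<close> is excluded by
  \<open>convex_closed_on\<close>), so the composite objective can be treated as a real number there.
\<close>

definition feasible :: "('m \<Rightarrow> 'n) \<Rightarrow> ('n \<Rightarrow> real ^ 'm \<Rightarrow> ereal) \<Rightarrow> real ^ 'm \<Rightarrow> bool" where
  "feasible b psi x \<longleftrightarrow> (\<forall>i. psi i (block b i x) < \<infinity>)"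

definition separable_real ::
  "('m \<Rightarrow> 'n::finite) \<Rightarrow> ('n \<Rightarrow> real ^ 'm \<Rightarrow> ereal) \<Rightarrow> real ^ 'm \<Rightarrow> real" where
  "separable_real b psi x = (\<Sum>i\<in>UNIV. real_of_ereal (psi i (block b i x)))"

locale block_composite =
  fixes b :: "'m::finite \<Rightarrow> 'n::finite"
    and B :: "'n \<Rightarrow> real ^ 'm ^ 'm"
    and f :: "real ^ 'm \<Rightarrow> real"
    and psi :: "'n \<Rightarrow> real ^ 'm \<Rightarrow> ereal"
    and v :: "real ^ 'n"
  assumes pos_def: "block_pos_def b i (B i)"
    and convex_f: "convex_on UNIV f"
    and differentiable_f: "f differentiable_on UNIV"
    and convex_closed_psi: "convex_closed_on (block_space b i) (psi i)"
    and v_pos: "v $ i > 0"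
begin

abbreviation "dom_psi \<equiv> feasible b psi"
abbreviation "psi_sum \<equiv> separable_real b psi"
abbreviation "sqnorm x \<equiv> (norm_w b B v x)\<^sup>2"

definition F_real :: "real ^ 'm \<Rightarrow> real" where
  "F_real x = f x + psi_sum x"

text \<open>
  The model of \<open>F\<close> around \<open>x\<close> suggested by the ESO inequality. Up to the constant \<open>f x - grad f x \<bullet> x\<close> it is the sum over all
  blocks of the objectives that \<open>pcdm_step\<close> minimises.
\<close>

definition model :: "real ^ 'm \<Rightarrow> real ^ 'm \<Rightarrow> real" where
  "model x y = f x + grad f x \<bullet> (y - x) + 1 / 2 * sqnorm (y - x) + psi_sum y"

definition prox_block :: "real ^ 'm \<Rightarrow> 'n \<Rightarrow> real ^ 'm \<Rightarrow> bool" where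
  "prox_block x i = is_arg_min
     (\<lambda>y. ereal (block b i (grad f x) \<bullet> y + v $ i / 2 * (block_norm B i (y - block b i x))\<^sup>2)
           + psi i y)
     (\<lambda>y. y \<in> block_space b i)"

definition prox_point :: "real ^ 'm \<Rightarrow> real ^ 'm \<Rightarrow> bool" where
  "prox_point x z \<longleftrightarrow> (\<forall>i. prox_block x i (block b i z))"

lemma pcdm_step_iff:
  "pcdm_step b B f psi v T x x' \<longleftrightarrow>
    (\<forall>i. if i \<in> T then prox_block x i (block b i x') else block b i x' = block b i x)"
  by (auto simp: pcdm_step_def prox_block_def)

lemma psi_not_MInfty: "y \<in> block_space b i \<Longrightarrow> psi i y \<noteq> -\<infinity>"
  using convex_closed_psi[of i] by (simp add: convex_closed_on_def)

lemma psi_dom: "dom_psi x \<Longrightarrow> psi i (block b i x) = ereal (real_of_ereal (psi i (block b i x)))"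
  using psi_not_MInfty[of "block b i x" i]
  by (cases "psi i (block b i x)") (auto simp: feasible_def)

lemma composite_dom:
  assumes "dom_psi x"
  shows "composite b f psi x = ereal (F_real x)"
proof -
  have "separable_sum b psi x = (\<Sum>i\<in>UNIV. ereal (real_of_ereal (psi i (block b i x))))"
    unfolding separable_sum_def by (intro sum.cong refl psi_dom assms)
  then show ?thesis by (simp add: composite_def F_real_def separable_real_def)
qed

lemma dom_iff: "dom_psi x \<longleftrightarrow> separable_sum b psi x < \<infinity>"
proof -
  have "separable_sum b psi x = \<infinity> \<longleftrightarrow> (\<exists>i. psi i (block b i x) = \<infinity>)"
    by (simp add: separable_sum_def sum_Pinfty)
  then show ?thesis by (auto simp: feasible_def less_top[symmetric])
qed

lemma prox_block_inequality:
  assumes "prox_block x i z" "y \<in> block_space b i" "psi i y < \<infinity>"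
  shows "psi i z < \<infinity>"
    and "block b i (grad f x) \<bullet> z + v $ i / 2 * (block_norm B i (z - block b i x))\<^sup>2
          + real_of_ereal (psi i z) + v $ i / 2 * (block_norm B i (y - z))\<^sup>2
      \<le> block b i (grad f x) \<bullet> y + v $ i / 2 * (block_norm B i (y - block b i x))\<^sup>2
          + real_of_ereal (psi i y)"
proof -
  have seg: "(block_norm B i ((1 - t) *\<^sub>R y + t *\<^sub>R z - block b i x))\<^sup>2
    = (1 - t) * (block_norm B i (y - block b i x))\<^sup>2 + t * (block_norm B i (z - block b i x))\<^sup>2
      - t * (1 - t) * (block_norm B i (z - y))\<^sup>2"
    if "y \<in> block_space b i" "z \<in> block_space b i" for y z t
    using pos_def that by (intro block_norm_segment) auto
  have epi: "convex (ereal_epigraph (block_space b i) (psi i))"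
    using convex_closed_psi[of i] by (simp add: convex_closed_on_def)
  note prox = prox_inequality[OF epi psi_not_MInfty,
      of "\<lambda>y. (block_norm B i y)\<^sup>2", OF _ seg assms(1)[unfolded prox_block_def] assms(2,3)]
  show "psi i z < \<infinity>" by (rule prox(1))
  show "block b i (grad f x) \<bullet> z + v $ i / 2 * (block_norm B i (z - block b i x))\<^sup>2
          + real_of_ereal (psi i z) + v $ i / 2 * (block_norm B i (y - z))\<^sup>2
      \<le> block b i (grad f x) \<bullet> y + v $ i / 2 * (block_norm B i (y - block b i x))\<^sup>2
          + real_of_ereal (psi i y)"
    by (rule prox(2))
qed

text \<open>Two minimisers: adding their proximal inequalities bounds their squared distance by zero.\<close>

lemma prox_block_unique:
  assumes "dom_psi x" "prox_block x i z" "prox_block x i z'"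
  shows "z = z'"
proof -
  have mem: "z \<in> block_space b i" "z' \<in> block_space b i"
    using assms(2,3) by (auto simp: prox_block_def is_arg_min_def)
  have x: "block b i x \<in> block_space b i" "psi i (block b i x) < \<infinity>"
    using assms(1) by (auto simp: feasible_def)
  have fin: "psi i z < \<infinity>" "psi i z' < \<infinity>"
    using prox_block_inequality(1)[OF _ x] assms(2,3) by auto
  have "v $ i * (block_norm B i (z - z'))\<^sup>2 \<le> 0"
    using prox_block_inequality(2)[OF assms(2) mem(2) fin(2)]
      prox_block_inequality(2)[OF assms(3) mem(1) fin(1)] block_norm_minus_commute[of B i z z']
    by simp
  then have "(block_norm B i (z - z'))\<^sup>2 \<le> 0"
    using v_pos[of i] by (simp add: mult_le_0_iff)
  then have "z - z' = 0"
    by (intro block_norm_eq_0[OF pos_def]) (auto simp: mem)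
  then show ?thesis by simp
qed

lemma sqnorm_sum: "sqnorm x = (\<Sum>i\<in>UNIV. v $ i * (block_norm B i (block b i x))\<^sup>2)"
  using v_pos by (intro norm_w_sq) (auto simp: less_imp_le)

lemma sqnorm_commute: "sqnorm (y - u) = sqnorm (u - y)"
  by (simp add: sqnorm_sum block_norm_minus_commute[of B _ "block b _ y"])

text \<open>The proximal inequalities of the single blocks add up since the model is separable.\<close>

lemma prox_point_inequality:
  assumes "dom_psi x" "prox_point x z" "dom_psi y"
  shows "model x z + 1 / 2 * sqnorm (y - z) \<le> model x y"
proof -
  have "(\<Sum>i\<in>UNIV. block b i (grad f x) \<bullet> block b i z
          + v $ i / 2 * (block_norm B i (block b i z - block b i x))\<^sup>2
          + real_of_ereal (psi i (block b i z))
          + v $ i / 2 * (block_norm B i (block b i y - block b i z))\<^sup>2)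
      \<le> (\<Sum>i\<in>UNIV. block b i (grad f x) \<bullet> block b i y
          + v $ i / 2 * (block_norm B i (block b i y - block b i x))\<^sup>2
          + real_of_ereal (psi i (block b i y)))"
    using assms by (intro sum_mono prox_block_inequality(2)) (auto simp: prox_point_def feasible_def)
  then show ?thesis
    by (simp add: model_def sqnorm_sum separable_real_def sum.distrib sum_inner_block inner_diff_right
        sum_divide_distrib)
qed

lemma pcdm_step_dom:
  assumes "dom_psi x" "pcdm_step b B f psi v T x x'"
  shows "dom_psi x'"
  unfolding feasible_def
proof
  fix i
  show "psi i (block b i x') < \<infinity>"
  proof (cases "i \<in> T")
    case True
    then show ?thesis
      using assms by (intro prox_block_inequality(1)[of x i "block b i x'" "block b i x"])
        (auto simp: pcdm_step_iff feasible_def split: if_splits)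
  next
    case False
    then show ?thesis
      using assms by (simp add: pcdm_step_iff feasible_def)
  qed
qed

lemma pcdm_step_unique:
  assumes "dom_psi x" "pcdm_step b B f psi v T x x'" "pcdm_step b B f psi v T x x''"
  shows "x' = x''"
proof (rule blocks_determine)
  show "block b i x' = block b i x''" for i
    using assms prox_block_unique[OF assms(1), of i "block b i x'" "block b i x''"]
    by (cases "i \<in> T") (auto simp: pcdm_step_iff split: if_splits)
qed

lemma pcdm_step_prox_point:
  assumes "prox_point x z"
  shows "pcdm_step b B f psi v T x (x + restrict_blocks b T (z - x))"
  using assms by (simp add: pcdm_step_iff block_restrict_blocks prox_point_def)

text \<open>Vectors supported on different blocks have disjoint supports, so the minimisers can be glued.\<close>

lemma prox_point_exists:
  assumes "\<And>i. \<exists>y. prox_block x i (block b i y)"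
  shows "\<exists>z. prox_point x z"
proof -
  obtain Y where Y: "prox_block x i (block b i (Y i))" for i
    using assms by metis
  have "block b i (\<chi> j. Y (b j) $ j) = block b i (Y i)" for i
    by (simp add: vec_eq_iff)
  with Y show ?thesis unfolding prox_point_def by metis
qed

text \<open>
  A step of the method as a function, so that its iterates become an \<open>orbit\<close>. On the domain of \<open>psi\<close>
  the choice is forced (\<open>pcdm_next_eq\<close>) as soon as the drawn blocks have minimisers.
\<close>

definition pcdm_next :: "real ^ 'm \<Rightarrow> 'n set \<Rightarrow> real ^ 'm" where
  "pcdm_next x T = (SOME x'. pcdm_step b B f psi v T x x')"

lemma pcdm_next_eq:
  assumes "dom_psi x" "pcdm_step b B f psi v T x x'"
  shows "pcdm_next x T = x'"
  unfolding pcdm_next_def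
  using assms(2) pcdm_step_unique[OF assms(1) _ assms(2)] by (rule some_equality)

end

section \<open>The expected effect of one step\<close>

locale pcdm_problem = block_composite b B f psi v
  for b :: "'m::finite \<Rightarrow> 'n::finite" and B f psi v +
  fixes Shat :: "'n set pmf"
  assumes proper: "proper_sampling Shat"
    and uniform: "uniform_sampling Shat"
    and eso: "ESO b B f Shat v"
begin

definition \<alpha> :: real where
  "\<alpha> = measure_pmf.expectation Shat (\<lambda>T. real (card T)) / real CARD('n)"

text \<open>
  Only the marginal probabilities enter the expectation of a separable quantity, whatever the joint
  law of the drawn blocks.
\<close>

lemma expectation_blockwise:
  "measure_pmf.expectation Shat (\<lambda>T. \<Sum>i\<in>UNIV. if i \<in> T then c i else d i)
    = (\<Sum>i\<in>UNIV. sampling_prob Shat $ i * c i + (1 - sampling_prob Shat $ i) * d i)"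
  for c d :: "'n \<Rightarrow> real"
proof -
  have int: "integrable Shat g" for g :: "'n set \<Rightarrow> real"
    by (rule integrable_measure_pmf_finite) simp
  have "measure_pmf.expectation Shat (\<lambda>T. if i \<in> T then c i else d i)
      = sampling_prob Shat $ i * c i + (1 - sampling_prob Shat $ i) * d i" for i
  proof -
    have "(\<lambda>T. if i \<in> T then c i else d i) = (\<lambda>T. d i + (c i - d i) * indicator {T. i \<in> T} T)"
      by (auto simp: fun_eq_iff indicator_def)
    then show ?thesis
      by (simp add: int sampling_prob_def algebra_simps)
  qed
  then show ?thesis by (simp add: int)
qed

lemma sampling_prob_eq: "sampling_prob Shat $ i = \<alpha>"
proof -
  define c where "c = sampling_prob Shat $ i"
  have eq: "sampling_prob Shat $ j = c" for j
    using uniform unfolding uniform_sampling_def c_def by blast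
  have card: "real (card T) = (\<Sum>i\<in>UNIV. if i \<in> T then 1 else 0)" for T :: "'n set"
    by (simp add: sum.If_cases)
  have "measure_pmf.expectation Shat (\<lambda>T. real (card T))
      = (\<Sum>i\<in>UNIV. sampling_prob Shat $ i * 1 + (1 - sampling_prob Shat $ i) * 0)"
    unfolding card by (rule expectation_blockwise)
  also have "\<dots> = real CARD('n) * c"
    by (simp add: eq)
  finally show ?thesis by (simp add: \<alpha>_def eq)
qed

lemma \<alpha>_pos: "0 < \<alpha>"
  using proper by (simp add: proper_sampling_def sampling_prob_eq)

lemma expectation_step_blocks:
  "measure_pmf.expectation Shat (\<lambda>T. \<Sum>i\<in>UNIV. g i (block b i (x + restrict_blocks b T (z - x))))
    = (1 - \<alpha>) * (\<Sum>i\<in>UNIV. g i (block b i x)) + \<alpha> * (\<Sum>i\<in>UNIV. g i (block b i z))"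
  for g :: "'n \<Rightarrow> real ^ 'm \<Rightarrow> real"
proof -
  have "measure_pmf.expectation Shat (\<lambda>T. \<Sum>i\<in>UNIV. g i (block b i (x + restrict_blocks b T (z - x))))
      = measure_pmf.expectation Shat
          (\<lambda>T. \<Sum>i\<in>UNIV. if i \<in> T then g i (block b i z) else g i (block b i x))"
    by (simp add: block_restrict_blocks if_distrib cong: if_cong)
  also have "\<dots> = (\<Sum>i\<in>UNIV. \<alpha> * g i (block b i z) + (1 - \<alpha>) * g i (block b i x))"
    by (simp only: expectation_blockwise sampling_prob_eq)
  finally show ?thesis
    by (simp add: sum.distrib sum_distrib_left)
qed

lemma eso_uniform:
  "measure_pmf.expectation Shat (\<lambda>T. f (x + restrict_blocks b T h))
    \<le> f x + \<alpha> * (grad f x \<bullet> h + 1 / 2 * sqnorm h)"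
proof -
  have "inner_w b (sampling_prob Shat) (grad f x) h = \<alpha> * (grad f x \<bullet> h)"
    by (simp add: inner_w_def sampling_prob_eq sum_inner_block flip: sum_distrib_left)
  moreover have "(norm_w b B (v * sampling_prob Shat) h)\<^sup>2 = \<alpha> * sqnorm h"
  proof -
    have "(norm_w b B (v * sampling_prob Shat) h)\<^sup>2
        = (\<Sum>i\<in>UNIV. (v * sampling_prob Shat) $ i * (block_norm B i (block b i h))\<^sup>2)"
      using v_pos \<alpha>_pos by (intro norm_w_sq) (auto simp: sampling_prob_eq less_imp_le)
    then show ?thesis by (simp add: sqnorm_sum sampling_prob_eq sum_distrib_left mult_ac)
  qed
  ultimately show ?thesis
    using eso[unfolded ESO_def, rule_format, of x h] by (simp add: algebra_simps)
qed

context
  fixes x z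
  assumes x: "dom_psi x" and z: "prox_point x z"
begin

text \<open>
  The ESO inequality bounds the smooth part, with linear and quadratic terms scaled by the same
  \<open>\<alpha>\<close>; the separable part is averaged exactly.
\<close>

lemma expectation_model:
  "measure_pmf.expectation Shat (\<lambda>T. F_real (pcdm_next x T)) \<le> (1 - \<alpha>) * F_real x + \<alpha> * model x z"
proof -
  have int: "integrable Shat g" for g :: "'n set \<Rightarrow> real"
    by (rule integrable_measure_pmf_finite) simp
  have next_eq: "pcdm_next x T = x + restrict_blocks b T (z - x)" for T
    by (rule pcdm_next_eq[OF x pcdm_step_prox_point[OF z]])
  have "measure_pmf.expectation Shat (\<lambda>T. psi_sum (pcdm_next x T))
      = (1 - \<alpha>) * psi_sum x + \<alpha> * psi_sum z"
    unfolding separable_real_def next_eq by (rule expectation_step_blocks)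
  then show ?thesis
    using eso_uniform[of x "z - x"]
    by (simp add: F_real_def int next_eq[symmetric] model_def algebra_simps)
qed

lemma expectation_sqnorm:
  "measure_pmf.expectation Shat (\<lambda>T. sqnorm (pcdm_next x T - y))
    = (1 - \<alpha>) * sqnorm (x - y) + \<alpha> * sqnorm (z - y)"
proof -
  have next_eq: "pcdm_next x T = x + restrict_blocks b T (z - x)" for T
    by (rule pcdm_next_eq[OF x pcdm_step_prox_point[OF z]])
  show ?thesis
    unfolding sqnorm_sum next_eq block_diff
    by (rule expectation_step_blocks[of "\<lambda>i u. v $ i * (block_norm B i (u - block b i y))\<^sup>2"])
qed

text \<open>The minimiser \<open>z\<close> does at least as well as \<open>x\<close> in the model, which is exact at \<open>x\<close>.\<close>

lemma expected_decrease:
  "measure_pmf.expectation Shat (\<lambda>T. F_real (pcdm_next x T)) \<le> F_real x"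
proof -
  have "block b i (0 :: real ^ 'm) = 0" for i
    by (simp add: vec_eq_iff)
  then have "model x x = F_real x"
    by (simp add: model_def F_real_def sqnorm_sum block_norm_def)
  then have "model x z \<le> F_real x"
    using prox_point_inequality[OF x z x] zero_le_power2[of "norm_w b B v (x - z)"] by linarith
  then have "\<alpha> * model x z \<le> \<alpha> * F_real x"
    using \<alpha>_pos by (intro mult_left_mono) auto
  with expectation_model show ?thesis by (simp add: algebra_simps)
qed

text \<open>
  By convexity \<open>model x y\<close> exceeds \<open>F_real y\<close> by at most the quadratic term. The quadratic gain at
  \<open>z\<close> is exactly what turns that term into the change of the expected squared distance to \<open>y\<close>.
\<close>

lemma expected_progress:
  assumes "dom_psi y"
  shows "measure_pmf.expectation Shat (\<lambda>T. F_real (pcdm_next x T) - F_real y)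
      + measure_pmf.expectation Shat (\<lambda>T. 1 / 2 * sqnorm (pcdm_next x T - y))
    \<le> (1 - \<alpha>) * (F_real x - F_real y) + 1 / 2 * sqnorm (x - y)"
proof -
  have int: "integrable Shat g" for g :: "'n set \<Rightarrow> real"
    by (rule integrable_measure_pmf_finite) simp
  have "model x y \<le> F_real y + 1 / 2 * sqnorm (y - x)"
    using gradient_inequality[OF convex_f differentiable_f, of x y]
    by (simp add: model_def F_real_def)
  then have "model x z \<le> F_real y + 1 / 2 * sqnorm (x - y) - 1 / 2 * sqnorm (z - y)"
    using prox_point_inequality[OF x z assms] sqnorm_commute[of y x] sqnorm_commute[of y z] by simp
  then have "\<alpha> * model x z \<le> \<alpha> * (F_real y + 1 / 2 * sqnorm (x - y) - 1 / 2 * sqnorm (z - y))"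
    using \<alpha>_pos by (intro mult_left_mono) auto
  with expectation_model show ?thesis
    by (simp add: int expectation_sqnorm)
      (simp add: algebra_simps add_divide_distrib diff_divide_distrib)
qed

end

text \<open>In a proper sampling every block belongs to some set of positive probability.\<close>

lemma prox_point_of_steps:
  assumes "\<And>T. T \<in> set_pmf Shat \<Longrightarrow> \<exists>x'. pcdm_step b B f psi v T x x'"
  shows "\<exists>z. prox_point x z"
proof (rule prox_point_exists)
  fix i
  have "0 < measure_pmf.prob Shat {T. i \<in> T}"
    using proper by (simp add: proper_sampling_def sampling_prob_def)
  then have "set_pmf Shat \<inter> {T. i \<in> T} \<noteq> {}"
    by (metis less_irrefl measure_pmf_zero_iff)
  then obtain T where "T \<in> set_pmf Shat" "i \<in> T" by blast
  then show "\<exists>y. prox_block x i (block b i y)"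
    using assms[of T] by (auto simp: pcdm_step_iff split: if_splits)
qed

end

section \<open>The convergence rate\<close>

lemma ereal_expectation_eq_integral:
  assumes int: "integrable M g" and Y: "\<And>\<omega>. \<omega> \<in> space M \<Longrightarrow> Y \<omega> = ereal (g \<omega>)"
  shows "ereal_expectation M Y = ereal (integral\<^sup>L M g)"
proof -
  define p q where "p = (\<integral>\<^sup>+ \<omega>. ennreal (g \<omega>) \<partial>M)" and "q = (\<integral>\<^sup>+ \<omega>. ennreal (- g \<omega>) \<partial>M)"
  have "p < \<infinity>" "q < \<infinity>"
    using int by (auto simp: p_def q_def real_integrable_def less_top)
  then have fin: "enn2ereal p = ereal (enn2real p)" "enn2ereal q = ereal (enn2real q)"
    by (cases p; cases q; simp add: enn2ereal_ennreal)+
  have "(\<integral>\<^sup>+ \<omega>. e2ennreal (Y \<omega>) \<partial>M) = p" "(\<integral>\<^sup>+ \<omega>. e2ennreal (- Y \<omega>) \<partial>M) = q"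
    unfolding p_def q_def by (auto simp: Y intro!: nn_integral_cong)
  moreover have "integral\<^sup>L M g = enn2real p - enn2real q"
    using int by (simp add: real_lebesgue_integral_def p_def q_def)
  ultimately show ?thesis by (simp add: ereal_expectation_def fin)
qed

text \<open>
  The invariant \<open>(1 + a k) \<phi>\<^sub>k\<^sub>+\<^sub>1 + r\<^sub>k\<^sub>+\<^sub>1 \<le> (1 - a) \<phi>\<^sub>0 + r\<^sub>0\<close> is the telescoped recursion: each further
  step brings another \<open>a \<phi>\<^sub>k\<^sub>+\<^sub>1\<close> to the left-hand side, and by monotonicity the accumulated
  \<open>a (k + 1) \<phi>\<^sub>k\<^sub>+\<^sub>1\<close> may be replaced by \<open>a (k + 1) \<phi>\<^sub>k\<^sub>+\<^sub>2\<close>.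
\<close>

lemma sublinear_rate:
  fixes \<phi> r :: "nat \<Rightarrow> real"
  assumes progress: "\<And>k. \<phi> (Suc k) + r (Suc k) \<le> (1 - a) * \<phi> k + r k"
    and decrease: "\<And>k. \<phi> (Suc k) \<le> \<phi> k" and a: "0 \<le> a" and r: "\<And>k. 0 \<le> r k"
  shows "(1 + a * real k) * \<phi> (Suc k) \<le> (1 - a) * \<phi> 0 + r 0"
proof -
  have "(1 + a * real k) * \<phi> (Suc k) + r (Suc k) \<le> (1 - a) * \<phi> 0 + r 0"
  proof (induction k)
    case 0
    then show ?case using progress[of 0] by simp
  next
    case (Suc k)
    have "a * real (Suc k) * \<phi> (Suc (Suc k)) \<le> a * real (Suc k) * \<phi> (Suc k)"
      using a by (intro mult_left_mono decrease) auto
    then have "(1 + a * real (Suc k)) * \<phi> (Suc (Suc k)) + r (Suc (Suc k))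
        \<le> (1 + a * real k) * \<phi> (Suc k) + r (Suc k)"
      using progress[of "Suc k"] by (simp add: algebra_simps)
    with Suc show ?case by linarith
  qed
  with r[of "Suc k"] show ?thesis by linarith
qed

context pcdm_problem
begin

context
  fixes M :: "'a measure" and S :: "nat \<Rightarrow> 'a \<Rightarrow> 'n set" and x0 :: "real ^ 'm"
    and X :: "nat \<Rightarrow> 'a \<Rightarrow> real ^ 'm"
  assumes run: "pcdm b B f psi v Shat M S x0 X"
begin

interpretation prob_space M
  using run by (simp add: pcdm_def)

lemma indep_S: "indep_vars (\<lambda>_. count_space UNIV) S UNIV"
  and law_S: "distr M (count_space UNIV) (S k) = measure_pmf Shat"
  and dom_x0: "dom_psi x0"
  using run by (auto simp: pcdm_def dom_iff)

lemma step_X: "\<omega> \<in> space M \<Longrightarrow> pcdm_step b B f psi v (S k \<omega>) (X k \<omega>) (X (Suc k) \<omega>)"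
  using run by (auto simp: pcdm_def)

abbreviation iterate :: "nat \<Rightarrow> 'a \<Rightarrow> real ^ 'm" where
  "iterate k \<omega> \<equiv> orbit pcdm_next x0 (\<lambda>j. S j \<omega>) k"

text \<open>
  This holds everywhere, not just almost surely: a step from a feasible point leads to a feasible
  point, and feasibility of the current point determines the next one.
\<close>

lemma X_eq_iterate:
  assumes "\<omega> \<in> space M"
  shows "X k \<omega> = iterate k \<omega>" and "dom_psi (iterate k \<omega>)"
proof -
  have "X k \<omega> = iterate k \<omega> \<and> dom_psi (X k \<omega>)"
  proof (induction k)
    case 0
    show ?case using run assms dom_x0 by (simp add: pcdm_def)
  next
    case (Suc k)
    then show ?case
      using step_X[OF assms, of k] pcdm_next_eq pcdm_step_dom by simp metis
  qed
  then show "X k \<omega> = iterate k \<omega>" and "dom_psi (iterate k \<omega>)" by auto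
qed

lemma AE_prox_point: "AE \<omega> in M. dom_psi (iterate k \<omega>) \<and> (\<exists>z. prox_point (iterate k \<omega>) z)"
proof -
  have "AE \<omega> in M. \<forall>T\<in>set_pmf Shat. \<exists>x'. pcdm_step b B f psi v T (iterate k \<omega>) x'"
  proof (rule AE_orbit_all_inputs[OF indep_S law_S])
    fix \<omega> assume "\<omega> \<in> space M"
    then show "\<exists>x'. pcdm_step b B f psi v (S k \<omega>) (iterate k \<omega>) x'"
      using step_X[of \<omega> k] by (auto simp: X_eq_iterate(1))
  qed
  moreover have "AE \<omega> in M. dom_psi (iterate k \<omega>)"
    by (rule AE_I2) (rule X_eq_iterate(2))
  ultimately show ?thesis
    by eventually_elim (auto intro: prox_point_of_steps)
qed

lemma integrable_iterate: "integrable M (\<lambda>\<omega>. g (iterate k \<omega>))" for g :: "real ^ 'm \<Rightarrow> real"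
  by (rule integrable_orbit[OF indep_S law_S])

lemma expectation_iterate_Suc:
  "expectation (\<lambda>\<omega>. g (iterate (Suc k) \<omega>))
    = expectation (\<lambda>\<omega>. measure_pmf.expectation Shat (\<lambda>T. g (pcdm_next (iterate k \<omega>) T)))"
  for g :: "real ^ 'm \<Rightarrow> real"
  by (rule expectation_orbit_Suc[OF indep_S law_S])

text \<open>
  The one-step bounds hold at every state with a full set of block minimisers, hence almost surely
  along the run, and the tower rule turns them into recursions for the expectations.
\<close>

lemma expectation_F_bound:
  assumes y: "dom_psi y"
  shows "(1 + \<alpha> * real k) * (expectation (\<lambda>\<omega>. F_real (iterate (Suc k) \<omega>)) - F_real y)
    \<le> (1 - \<alpha>) * (F_real x0 - F_real y) + 1 / 2 * sqnorm (x0 - y)"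
proof -
  define gap dist where "gap = (\<lambda>x. F_real x - F_real y)"
    and "dist = (\<lambda>x. 1 / 2 * sqnorm (x - y))"
  define \<phi> r where "\<phi> = (\<lambda>k. expectation (\<lambda>\<omega>. gap (iterate k \<omega>)))"
    and "r = (\<lambda>k. expectation (\<lambda>\<omega>. dist (iterate k \<omega>)))"
  let ?E = "\<lambda>g x. measure_pmf.expectation Shat (\<lambda>T. g (pcdm_next x T)) :: real"
  have \<phi>_Suc: "\<phi> (Suc k) = expectation (\<lambda>\<omega>. ?E gap (iterate k \<omega>))"
    and r_Suc: "r (Suc k) = expectation (\<lambda>\<omega>. ?E dist (iterate k \<omega>))" for k
    unfolding \<phi>_def r_def by (rule expectation_iterate_Suc)+
  have "(1 + \<alpha> * real k) * \<phi> (Suc k) \<le> (1 - \<alpha>) * \<phi> 0 + r 0"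
  proof (rule sublinear_rate)
    fix k
    have "expectation (\<lambda>\<omega>. ?E gap (iterate k \<omega>) + ?E dist (iterate k \<omega>))
        \<le> expectation (\<lambda>\<omega>. (1 - \<alpha>) * gap (iterate k \<omega>) + dist (iterate k \<omega>))"
    proof (rule integral_mono_AE[OF integrable_iterate integrable_iterate])
      show "AE \<omega> in M. ?E gap (iterate k \<omega>) + ?E dist (iterate k \<omega>)
          \<le> (1 - \<alpha>) * gap (iterate k \<omega>) + dist (iterate k \<omega>)"
        using AE_prox_point[of k]
        by eventually_elim (auto simp only: gap_def dist_def intro: expected_progress[OF _ _ y])
    qed
    then show "\<phi> (Suc k) + r (Suc k) \<le> (1 - \<alpha>) * \<phi> k + r k"
      unfolding \<phi>_Suc r_Suc unfolding \<phi>_def r_def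
      by (simp add: integrable_iterate[of "\<lambda>x. ?E gap x"] integrable_iterate[of "\<lambda>x. ?E dist x"]
          integrable_iterate[of gap] integrable_iterate[of dist])
    have "expectation (\<lambda>\<omega>. ?E gap (iterate k \<omega>)) \<le> expectation (\<lambda>\<omega>. gap (iterate k \<omega>))"
    proof (rule integral_mono_AE[OF integrable_iterate integrable_iterate])
      have "?E gap x = ?E F_real x - F_real y" for x
        unfolding gap_def
        by (subst Bochner_Integration.integral_diff) (auto intro: integrable_measure_pmf_finite)
      then have E_gap: "?E gap x \<le> gap x" if "dom_psi x" "prox_point x z" for x z
        using expected_decrease[OF that] by (simp only: gap_def)
      show "AE \<omega> in M. ?E gap (iterate k \<omega>) \<le> gap (iterate k \<omega>)"
        using AE_prox_point[of k] by eventually_elim (auto intro: E_gap)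
    qed
    then show "\<phi> (Suc k) \<le> \<phi> k" unfolding \<phi>_Suc unfolding \<phi>_def .
    show "0 \<le> r k" by (simp add: r_def dist_def)
  qed (use \<alpha>_pos in simp)
  moreover have "\<phi> (Suc k) = expectation (\<lambda>\<omega>. F_real (iterate (Suc k) \<omega>)) - F_real y"
    unfolding \<phi>_def gap_def
    by (subst Bochner_Integration.integral_diff) (simp_all only: integrable_iterate integrable_const,
        simp add: prob_space)
  ultimately show ?thesis
    by (simp add: \<phi>_def r_def gap_def dist_def prob_space)
qed

lemma ereal_expectation_X:
  "ereal_expectation M (\<lambda>\<omega>. composite b f psi (X k \<omega>) - ereal c)
    = ereal (expectation (\<lambda>\<omega>. F_real (iterate k \<omega>)) - c)"
proof -
  have "ereal_expectation M (\<lambda>\<omega>. composite b f psi (X k \<omega>) - ereal c)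
      = ereal (expectation (\<lambda>\<omega>. F_real (iterate k \<omega>) - c))"
    by (rule ereal_expectation_eq_integral[OF integrable_iterate])
      (simp add: X_eq_iterate composite_dom)
  also have "expectation (\<lambda>\<omega>. F_real (iterate k \<omega>) - c) = expectation (\<lambda>\<omega>. F_real (iterate k \<omega>)) - c"
    by (subst Bochner_Integration.integral_diff) (simp_all only: integrable_iterate integrable_const,
        simp add: prob_space)
  finally show ?thesis .
qed

end

end

theorem corollary7:
  fixes b :: "'m::finite \<Rightarrow> 'n::finite"
    and B :: "'n \<Rightarrow> real ^ 'm ^ 'm"
    and f :: "real ^ 'm \<Rightarrow> real"
    and psi :: "'n \<Rightarrow> real ^ 'm \<Rightarrow> ereal"
    and F :: "real ^ 'm \<Rightarrow> ereal"
    and Shat :: "'n set pmf"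
    and v :: "real ^ 'n"
    and \<tau> n :: real
    and M :: "'a measure"
    and S :: "nat \<Rightarrow> 'a \<Rightarrow> 'n set"
    and x0 xs :: "real ^ 'm"
    and X :: "nat \<Rightarrow> 'a \<Rightarrow> real ^ 'm"
  defines "n \<equiv> real CARD('n)"
    and "F \<equiv> composite b f psi"
    and "\<tau> \<equiv> measure_pmf.expectation Shat (\<lambda>T. real (card T))"
  assumes "surj b"
    and "\<And>i. block_pos_def b i (B i)"
    and "convex_on UNIV f"
    and "f differentiable_on UNIV"
    and "\<And>i. convex_closed_on (block_space b i) (psi i)"
    and "proper_sampling Shat"
    and "uniform_sampling Shat"
    and "\<And>i. v $ i > 0"
    and "ESO b B f Shat v"
    and "is_arg_min F (\<lambda>_. True) xs"
    and "pcdm b B f psi v Shat M S x0 X"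
  shows "(\<forall>k\<ge>1. ereal_expectation M (\<lambda>\<omega>. F (X k \<omega>)) - F xs
            \<le> ereal (n / ((real k - 1) * \<tau> + n)) *
               (ereal (1 - \<tau> / n) * (F x0 - F xs) + ereal (1 / 2 * (norm_w b B v (x0 - xs))\<^sup>2))) \<and>
         (\<forall>\<epsilon> k. 0 < \<epsilon> \<and>
            ereal \<epsilon> < ereal (1 - \<tau> / n) * (F x0 - F xs) + ereal (1 / 2 * (norm_w b B v (x0 - xs))\<^sup>2) \<and>
            (ereal (n - \<tau>) * (F x0 - F xs) + ereal (n / 2 * (norm_w b B v (x0 - xs))\<^sup>2)) / ereal (\<tau> * \<epsilon>)
              - ereal (n / \<tau>) + 1 \<le> ereal (real k) \<longrightarrow>
            ereal_expectation M (\<lambda>\<omega>. F (X k \<omega>) - F xs) \<le> ereal \<epsilon>)"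
proof -
  interpret pcdm_problem b B f psi v Shat
    using assms by unfold_locales auto
  note run = \<open>pcdm b B f psi v Shat M S x0 X\<close>
  have n: "0 < n" by (simp add: n_def)
  have \<alpha>_eq: "\<alpha> = \<tau> / n" by (simp add: \<alpha>_def \<tau>_def n_def)
  have \<tau>: "0 < \<tau>" using \<alpha>_pos n by (simp add: \<alpha>_eq zero_less_divide_iff)
  have x0: "dom_psi x0" by (rule dom_x0[OF run])
  have "F xs \<le> F x0" using \<open>is_arg_min F (\<lambda>_. True) xs\<close> by (auto simp: is_arg_min_def not_less)
  then have "F xs < \<infinity>" by (auto simp: F_def composite_dom[OF x0])
  then have xs: "dom_psi xs" by (auto simp: dom_iff F_def composite_def)
  have F_x0: "F x0 = ereal (F_real x0)" and F_xs: "F xs = ereal (F_real xs)"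
    using x0 xs by (auto simp: F_def composite_dom)
  define e where "e k = integral\<^sup>L M (\<lambda>\<omega>. F_real (orbit pcdm_next x0 (\<lambda>j. S j \<omega>) k)) - F_real xs" for k
  define C where "C = (1 - \<tau> / n) * (F_real x0 - F_real xs) + 1 / 2 * (norm_w b B v (x0 - xs))\<^sup>2"
  have gap: "ereal_expectation M (\<lambda>\<omega>. F (X k \<omega>) - F xs) = ereal (e k)" for k
    unfolding F_xs unfolding F_def e_def by (rule ereal_expectation_X[OF run])
  have gap': "ereal_expectation M (\<lambda>\<omega>. F (X k \<omega>)) - F xs = ereal (e k)" for k
    using ereal_expectation_X[OF run, of k 0] 
    unfolding F_xs unfolding F_def e_def by (simp flip: zero_ereal_def)
  have bound: "((real k - 1) * \<tau> + n) * e k \<le> n * C" if k: "k \<ge> 1" for k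
  proof -
    obtain l where l: "k = Suc l" using k by (cases k) auto
    have "n * ((1 + \<alpha> * real l) * e k) \<le> n * C"
      using expectation_F_bound[OF run xs, of l] n
      by (intro mult_left_mono) (auto simp: C_def \<alpha>_eq e_def l)
    moreover have "n * ((1 + \<alpha> * real l) * e k) = ((real k - 1) * \<tau> + n) * e k"
      using n by (simp add: \<alpha>_eq l field_simps)
    ultimately show ?thesis by simp
  qed
  show ?thesis
  proof (intro conjI allI impI)
    fix k :: nat assume k: "1 \<le> k"
    then have "0 < (real k - 1) * \<tau> + n"
      using n \<tau> by (intro add_nonneg_pos) auto
    then have "e k \<le> n / ((real k - 1) * \<tau> + n) * C"
      using bound[OF k] by (simp add: field_simps)
    then show "ereal_expectation M (\<lambda>\<omega>. F (X k \<omega>)) - F xs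
            \<le> ereal (n / ((real k - 1) * \<tau> + n)) *
               (ereal (1 - \<tau> / n) * (F x0 - F xs) + ereal (1 / 2 * (norm_w b B v (x0 - xs))\<^sup>2))"
      unfolding gap' unfolding F_x0 F_xs by (simp add: C_def)
  next
    fix \<epsilon> :: real and k :: nat
    assume "0 < \<epsilon> \<and>
            ereal \<epsilon> < ereal (1 - \<tau> / n) * (F x0 - F xs) + ereal (1 / 2 * (norm_w b B v (x0 - xs))\<^sup>2) \<and>
            (ereal (n - \<tau>) * (F x0 - F xs) + ereal (n / 2 * (norm_w b B v (x0 - xs))\<^sup>2)) / ereal (\<tau> * \<epsilon>)
              - ereal (n / \<tau>) + 1 \<le> ereal (real k)"
    then have \<epsilon>: "0 < \<epsilon>" "\<epsilon> < C"
      and k: "((n - \<tau>) * (F_real x0 - F_real xs) + n / 2 * (norm_w b B v (x0 - xs))\<^sup>2) / (\<tau> * \<epsilon>)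
          - n / \<tau> + 1 \<le> real k"
      using \<tau> by (auto simp: F_x0 F_xs C_def one_ereal_def)
    have "(n - \<tau>) * (F_real x0 - F_real xs) + n / 2 * (norm_w b B v (x0 - xs))\<^sup>2 = n * C"
      using n by (simp add: C_def field_simps)
    with k have "n * C / (\<tau> * \<epsilon>) - n / \<tau> \<le> real k - 1" by simp
    then have "\<tau> * (n * C / (\<tau> * \<epsilon>) - n / \<tau>) \<le> \<tau> * (real k - 1)"
      using \<tau> by (intro mult_left_mono) auto
    moreover have "\<tau> * (n * C / (\<tau> * \<epsilon>) - n / \<tau>) = n * C / \<epsilon> - n"
      using \<tau> by (simp add: right_diff_distrib)
    ultimately have *: "n * C / \<epsilon> \<le> (real k - 1) * \<tau> + n"
      by (simp add: mult.commute)
    \<comment> \<open>The assumption \<open>\<epsilon> < C\<close> is what rules out \<open>k = 0\<close>, to which the rate does not apply.\<close>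
    have "n < n * C / \<epsilon>" using n \<epsilon> by (simp add: field_simps)
    with * have "0 < (real k - 1) * \<tau>" by simp
    then have k1: "1 \<le> k" using \<tau> by (simp add: zero_less_mult_iff)
    have pos: "0 < (real k - 1) * \<tau> + n" using \<open>0 < (real k - 1) * \<tau>\<close> n by simp
    have "((real k - 1) * \<tau> + n) * e k \<le> n * C" by (rule bound[OF k1])
    also have "\<dots> \<le> ((real k - 1) * \<tau> + n) * \<epsilon>"
      using * \<epsilon> by (simp add: pos_divide_le_eq)
    finally have "e k \<le> \<epsilon>" using pos by simp
    then show "ereal_expectation M (\<lambda>\<omega>. F (X k \<omega>) - F xs) \<le> ereal \<epsilon>"
      unfolding gap by simp
  qed
qed

end
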